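(* Let $A$ be a finite skew left brace such that $(A,+)$ and $(A,\circ)$ are nilpotent. Let $I_1,\dots,I_n$ be the distinct Sylow subgroups of the additive group $(A,+)$. Then $I_1,\dots,I_n$ are ideals of $A$ and the map $f\colon A\to I_1\times\cdots\times I_n$ defined by $f(a_1+\cdots+a_n)=(a_1,\dots,a_n)$, for all $a_j\in I_j$, is an isomorphism of skew left braces.
   Context: A skew left brace is a triple $(A,+,\circ)$ where $(A,+)$ and $(A,\circ)$ are (not necessarily abelian) groups such that $a\circ(b+c)=a\circ b-a+a\circ c$ for all $a,b,c\in A$. For $a,b\in A$ put $\lambda_a(b)=-a+a\circ b$. A left ideal of $A$ is a subgroup $I$ of $(A,+)$ with $\lambda_a(I)\subseteq I$ for all $a\in A$ (it is then also a subgroup of $(A,\circ)$). An ideal of $A$ is a left ideal $I$ such that $a\circ I=I\circ a$ and $a+I=I+a$ for all $a\in A$. An ideal is itself a skew left brace under the restricted operations; the operations of a direct product of skew left braces are defined componentwise. An isomorphism of skew left braces is a bijection preserving both operations. *)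

theory Defs
  imports "HOL-Algebra.Algebra"
begin

text \<open>The ring record of \<open>HOL-Algebra\<close> carries the two operations of a skew left brace:
  \<open>\<oplus>\<close>, \<open>\<ominus>\<close>, \<open>\<zero>\<close> for the additive group \<open>add_monoid A\<close>, which need not be abelian, and
  \<open>\<otimes>\<close>, \<open>\<one>\<close> for the circle group, which is \<open>A\<close> itself read as a monoid record.
  Only the carrier, addition and multiplication are data; the two neutral elements are
  determined by the group axioms.\<close>

locale skew_left_brace =
  fixes A (structure)
  assumes add_group: "group (add_monoid A)"
    and mult_group: "group A"
    and brace_compat:
      "\<lbrakk>a \<in> carrier A; b \<in> carrier A; c \<in> carrier A\<rbrakk>
        \<Longrightarrow> a \<otimes> (b \<oplus> c) = (a \<otimes> b \<ominus> a) \<oplus> (a \<otimes> c)"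

definition brace_lambda :: "('a, 'm) ring_scheme \<Rightarrow> 'a \<Rightarrow> 'a \<Rightarrow> 'a" where
  "brace_lambda A a b = (\<ominus>\<^bsub>A\<^esub> a) \<oplus>\<^bsub>A\<^esub> (a \<otimes>\<^bsub>A\<^esub> b)"

definition brace_left_ideal :: "'a set \<Rightarrow> ('a, 'm) ring_scheme \<Rightarrow> bool" where
  "brace_left_ideal I A \<longleftrightarrow>
     subgroup I (add_monoid A) \<and> (\<forall>a\<in>carrier A. brace_lambda A a ` I \<subseteq> I)"

definition brace_ideal :: "'a set \<Rightarrow> ('a, 'm) ring_scheme \<Rightarrow> bool" where
  "brace_ideal I A \<longleftrightarrow>
     brace_left_ideal I A \<and>
     (\<forall>a\<in>carrier A. a <#\<^bsub>A\<^esub> I = I #>\<^bsub>A\<^esub> a \<and> a <+\<^bsub>A\<^esub> I = I +>\<^bsub>A\<^esub> a)"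

definition brace_product :: "'i set \<Rightarrow> ('i \<Rightarrow> ('a, 'm) ring_scheme) \<Rightarrow> ('i \<Rightarrow> 'a) ring" where
  "brace_product J B =
     \<lparr>carrier = (\<Pi>\<^sub>E j\<in>J. carrier (B j)),
      monoid.mult = (\<lambda>x y. \<lambda>j\<in>J. x j \<otimes>\<^bsub>B j\<^esub> y j),
      monoid.one = (\<lambda>j\<in>J. \<one>\<^bsub>B j\<^esub>),
      ring.zero = (\<lambda>j\<in>J. \<zero>\<^bsub>B j\<^esub>),
      ring.add = (\<lambda>x y. \<lambda>j\<in>J. x j \<oplus>\<^bsub>B j\<^esub> y j)\<rparr>"

definition brace_iso :: "('a, 'm) ring_scheme \<Rightarrow> ('b, 'n) ring_scheme \<Rightarrow> ('a \<Rightarrow> 'b) set" where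
  "brace_iso A B = iso (add_monoid A) (add_monoid B) \<inter> iso A B"

text \<open>The sum is taken in the order of the list, since addition need not commute.\<close>

definition brace_sum :: "('a, 'm) ring_scheme \<Rightarrow> 'a list \<Rightarrow> 'a" where
  "brace_sum A xs = foldr (\<oplus>\<^bsub>A\<^esub>) xs \<zero>\<^bsub>A\<^esub>"

definition commutator_subgroup :: "('a, 'm) monoid_scheme \<Rightarrow> 'a set \<Rightarrow> 'a set \<Rightarrow> 'a set" where
  "commutator_subgroup G H K =
     generate G (\<Union>h\<in>H. \<Union>k\<in>K. {h \<otimes>\<^bsub>G\<^esub> k \<otimes>\<^bsub>G\<^esub> inv\<^bsub>G\<^esub> h \<otimes>\<^bsub>G\<^esub> inv\<^bsub>G\<^esub> k})"

primrec lower_central :: "('a, 'm) monoid_scheme \<Rightarrow> nat \<Rightarrow> 'a set" where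
  "lower_central G 0 = carrier G"
| "lower_central G (Suc c) = commutator_subgroup G (lower_central G c) (carrier G)"

definition nilpotent_group :: "('a, 'm) monoid_scheme \<Rightarrow> bool" where
  "nilpotent_group G \<longleftrightarrow> group G \<and> (\<exists>c. lower_central G c = {\<one>\<^bsub>G\<^esub>})"

text \<open>For finite groups. Only primes dividing the order are considered, so a Sylow subgroup
  is never trivial and the trivial group has none.\<close>

definition sylow_subgroup :: "('a, 'm) monoid_scheme \<Rightarrow> 'a set \<Rightarrow> bool" where
  "sylow_subgroup G P \<longleftrightarrow>
     subgroup P G \<and>
     (\<exists>p::nat. Factorial_Ring.prime p \<and> p dvd order G \<and> card P = p ^ multiplicity p (order G))"

lemma skew_left_brace_product:
  assumes B: "\<And>j. j \<in> J \<Longrightarrow> skew_left_brace (B j)"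
  shows "skew_left_brace (brace_product J B)"
proof -
  let ?P = "brace_product J B"
  have add_eq: "add_monoid ?P = product_group J (\<lambda>j. add_monoid (B j))"
    by (simp add: brace_product_def product_group_def)
  have addg: "group (add_monoid (B j))" and multg: "group (B j)" if "j \<in> J" for j
    using B[OF that] by (auto simp: skew_left_brace_def)
  have mult_eq: "carrier ?P = carrier (product_group J B)"
      "monoid.mult ?P = monoid.mult (product_group J B)"
      "monoid.one ?P = monoid.one (product_group J B)"
    by (simp_all add: brace_product_def product_group_def)
  have "group (product_group J B)"
    using multg by simp
  then have g: "group ?P"
    unfolding group_def group_axioms_def monoid_def Units_def mult_eq .
  have ag: "group (add_monoid ?P)"
    unfolding add_eq using addg by simp
  have inv: "\<ominus>\<^bsub>?P\<^esub> a = (\<lambda>j\<in>J. \<ominus>\<^bsub>B j\<^esub> a j)" if "a \<in> carrier ?P" for a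
    unfolding a_inv_def add_eq
    using that addg by (subst inv_product_group) (auto simp: brace_product_def)
  show ?thesis
  proof (rule skew_left_brace.intro)
    fix a b c assume "a \<in> carrier ?P" "b \<in> carrier ?P" "c \<in> carrier ?P"
    note mem = this
    then have "a j \<otimes>\<^bsub>B j\<^esub> (b j \<oplus>\<^bsub>B j\<^esub> c j) =
        (a j \<otimes>\<^bsub>B j\<^esub> b j \<ominus>\<^bsub>B j\<^esub> a j) \<oplus>\<^bsub>B j\<^esub> (a j \<otimes>\<^bsub>B j\<^esub> c j)" if "j \<in> J" for j
      using that
      by (intro skew_left_brace.brace_compat[OF B]) (auto simp: brace_product_def PiE_iff)
    then show "a \<otimes>\<^bsub>?P\<^esub> (b \<oplus>\<^bsub>?P\<^esub> c) =
        (a \<otimes>\<^bsub>?P\<^esub> b \<ominus>\<^bsub>?P\<^esub> a) \<oplus>\<^bsub>?P\<^esub> (a \<otimes>\<^bsub>?P\<^esub> c)"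
      unfolding a_minus_def inv[OF mem(1)]
      by (simp add: brace_product_def restrict_def fun_eq_iff)
  qed (fact ag g)+
qed

end

theory Submission
  imports Defs
begin

text \<open>In a nilpotent group let \<open>z\<close> be the commutator of two elements \<open>x\<close>, \<open>y\<close> of coprime orders.
  If \<open>z\<close> lies in a term of the lower central series, it is central modulo the next term; there \<open>x\<^sup>k y = z\<^sup>k y x\<^sup>k\<close>, so the order of \<open>z\<close>
  divides both orders, and \<open>z\<close> descends through the whole series. Hence a finite nilpotent group is
  the internal direct product of its Sylow subgroups, and the Sylow \<open>p\<close>-subgroup is the set of all
  \<open>p\<close>-elements. Every \<open>\<lambda>\<^sub>a\<close> is additive, so it preserves the additive Sylow subgroups; these are
  therefore left ideals, hence by cardinality the Sylow subgroups of the circle group, and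
  normal in both groups. Between different Sylow subgroups both operations commute, which forces
  \<open>x \<circ> y = x + y\<close>. So the ordered sum is also the ordered circle product, and the direct product
  decomposition of either group is given by one and the same map.\<close>

section \<open>Nilpotent groups\<close>

context group
begin

lemma mult_inv_cancel:
  assumes "x \<in> carrier G" "y \<in> carrier G"
  shows "inv x \<otimes> (x \<otimes> y) = y" "x \<otimes> (inv x \<otimes> y) = y"
  using assms by (simp_all add: m_assoc[symmetric])

lemma coprime_pow_trivial:
  fixes m n :: nat
  assumes "x \<in> carrier G" "x [^] m = \<one>" "x [^] n = \<one>" "coprime m n"
  shows "x = \<one>"
proof -
  have "ord x dvd m" "ord x dvd n"
    using assms by (simp_all add: pow_eq_id)
  then have "ord x = 1"
    using assms(4) coprime_common_divisor_nat by blast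
  then show ?thesis
    using ord_eq_1[OF assms(1)] by simp
qed

text \<open>Conjugation by \<open>g\<close> turns the commutator of \<open>h\<close> and
  \<open>k\<close> into that of their conjugates, and normality keeps the conjugate of
  \<open>h\<close> in \<open>N\<close>. The generating set is thus stable under conjugation.\<close>

lemma commutator_subgroup_normal:
  assumes "N \<lhd> G"
  shows "commutator_subgroup G N (carrier G) \<lhd> G"
  unfolding commutator_subgroup_def
proof (rule normal_generateI)
  interpret N: normal N G by fact
  show "(\<Union>h\<in>N. \<Union>k\<in>carrier G. {h \<otimes> k \<otimes> inv h \<otimes> inv k}) \<subseteq> carrier G"
    using N.subset by auto
  fix c g assume "c \<in> (\<Union>h\<in>N. \<Union>k\<in>carrier G. {h \<otimes> k \<otimes> inv h \<otimes> inv k})" and g: "g \<in> carrier G"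
  then obtain h k where h: "h \<in> N" "h \<in> carrier G" and k: "k \<in> carrier G"
    and c: "c = h \<otimes> k \<otimes> inv h \<otimes> inv k"
    using N.subset by auto
  define h' k' where "h' = g \<otimes> h \<otimes> inv g" and "k' = g \<otimes> k \<otimes> inv g"
  have "h' \<in> N" "k' \<in> carrier G"
    using N.inv_op_closed2 g h k by (auto simp: h'_def k'_def)
  moreover have "g \<otimes> c \<otimes> inv g = h' \<otimes> k' \<otimes> inv h' \<otimes> inv k'"
    using g h(2) k by (simp add: c h'_def k'_def m_assoc inv_mult_group mult_inv_cancel)
  ultimately show "g \<otimes> c \<otimes> inv g \<in> (\<Union>h\<in>N. \<Union>k\<in>carrier G. {h \<otimes> k \<otimes> inv h \<otimes> inv k})"
    by blast
qed

lemma lower_central_normal: "lower_central G c \<lhd> G"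
  by (induction c) (simp_all add: normal_self commutator_subgroup_normal)

text \<open>Moving one more factor \<open>x\<close> across \<open>y\<close> releases one more
  \<open>z\<close>, which commutes with \<open>x\<close> and so can be collected in front.\<close>

lemma central_commutator_pow:
  fixes k :: nat
  assumes "x \<in> carrier G" "y \<in> carrier G" "z \<in> carrier G"
    and "z \<otimes> x = x \<otimes> z" "z \<otimes> y = y \<otimes> z" "x \<otimes> y = z \<otimes> (y \<otimes> x)"
  shows "x [^] k \<otimes> y = z [^] k \<otimes> (y \<otimes> x [^] k)"
proof (induction k)
  case (Suc k)
  have zk: "z [^] k \<otimes> x = x \<otimes> z [^] k" "z [^] k \<otimes> z = z \<otimes> z [^] k"
    using assms by (simp_all add: group_commutes_pow)
  have "x [^] Suc k \<otimes> y = x \<otimes> (x [^] k \<otimes> y)"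
    using assms(1,2) by (simp only: nat_pow_Suc2 m_assoc nat_pow_closed)
  also have "\<dots> = (x \<otimes> z [^] k) \<otimes> (y \<otimes> x [^] k)"
    using assms by (simp add: Suc m_assoc)
  also have "\<dots> = z [^] k \<otimes> ((x \<otimes> y) \<otimes> x [^] k)"
    using assms(1-3) by (simp add: zk(1)[symmetric] m_assoc)
  also have "\<dots> = z [^] k \<otimes> ((z \<otimes> (y \<otimes> x)) \<otimes> x [^] k)"
    by (simp only: assms(6))
  also have "\<dots> = (z [^] k \<otimes> z) \<otimes> (y \<otimes> (x \<otimes> x [^] k))"
    using assms(1-3) by (simp add: m_assoc)
  also have "\<dots> = z [^] Suc k \<otimes> (y \<otimes> x [^] Suc k)"
    using assms(1) by (simp only: nat_pow_Suc2[of x] nat_pow_Suc[of z])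
  finally show ?case .
qed (use assms in simp)

text \<open>The power formula at \<open>x [^] m = \<one>\<close> yields
  \<open>z [^] m = \<one>\<close>. Exchanging \<open>x\<close> and \<open>y\<close> replaces
  \<open>z\<close> by its inverse, so \<open>y [^] n = \<one>\<close> yields
  \<open>z [^] n = \<one>\<close> as well.\<close>

lemma central_commutator_trivial:
  fixes m n :: nat
  assumes xyz: "x \<in> carrier G" "y \<in> carrier G" "z \<in> carrier G"
    and comm: "z \<otimes> x = x \<otimes> z" "z \<otimes> y = y \<otimes> z" "x \<otimes> y = z \<otimes> (y \<otimes> x)"
    and pow: "x [^] m = \<one>" "y [^] n = \<one>" and "coprime m n"
  shows "z = \<one>"
proof -
  have "y = z [^] m \<otimes> y"
    using central_commutator_pow[OF xyz comm, of m] xyz pow by simp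
  then have m: "z [^] m = \<one>"
    using xyz by (metis nat_pow_closed r_cancel_one')
  have "inv z \<otimes> y = y \<otimes> inv z" "inv z \<otimes> x = x \<otimes> inv z"
    using xyz comm by (metis inv_closed inv_solve_left inv_solve_right' m_assoc m_closed)+
  moreover have "y \<otimes> x = inv z \<otimes> (x \<otimes> y)"
    unfolding comm(3) using xyz by (simp add: mult_inv_cancel)
  ultimately have "x = (inv z) [^] n \<otimes> x"
    using central_commutator_pow[of y x "inv z" n] xyz pow by simp
  then have "(inv z) [^] n = \<one>"
    using xyz by (metis inv_closed nat_pow_closed r_cancel_one')
  then have n: "z [^] n = \<one>"
    using xyz by (simp add: nat_pow_inv)
  show ?thesis
    using coprime_pow_trivial[OF xyz(3) m n] \<open>coprime m n\<close> by simp
qed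

lemma coprime_pow_commute:
  fixes m n :: nat
  assumes "nilpotent_group G" and xy: "x \<in> carrier G" "y \<in> carrier G"
    and pow: "x [^] m = \<one>" "y [^] n = \<one>" and "coprime m n"
  shows "x \<otimes> y = y \<otimes> x"
proof -
  define z where "z = x \<otimes> y \<otimes> inv x \<otimes> inv y"
  have z: "z \<in> carrier G"
    using xy by (simp add: z_def)
  have zxy: "x \<otimes> y = z \<otimes> (y \<otimes> x)"
    using xy by (simp add: z_def m_assoc mult_inv_cancel)
  have "z \<in> lower_central G c" for c
  proof (induction c)
    case (Suc c)
    let ?N = "lower_central G (Suc c)"
    interpret N: normal ?N G by (rule lower_central_normal)
    interpret Q: group "G Mod ?N" by (rule N.factorgroup_is_group)
    interpret h: group_hom G "G Mod ?N" "\<lambda>a. ?N #> a"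
      by unfold_locales (rule N.r_coset_hom_Mod)
    have N_one: "(?N #> a = \<one>\<^bsub>G Mod ?N\<^esub>) = (a \<in> ?N)" if "a \<in> carrier G" for a
      using that coset_join1[OF _ that N.subgroup_axioms] N.rcos_const[OF is_group]
      by (auto simp: FactGroup_def)
    \<comment> \<open>Commutators of \<open>z\<close> with elements of \<open>G\<close> lie in
      \<open>?N\<close> by definition of the series, since \<open>z\<close> lies in the preceding
      term.\<close>
    have central: "(?N #> z) \<otimes>\<^bsub>G Mod ?N\<^esub> (?N #> k) = (?N #> k) \<otimes>\<^bsub>G Mod ?N\<^esub> (?N #> z)"
      if k: "k \<in> carrier G" for k
    proof -
      define w where "w = z \<otimes> k \<otimes> inv z \<otimes> inv k"
      have "w \<in> ?N"
        using Suc k by (auto simp: w_def commutator_subgroup_def intro!: generate.incl)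
      moreover have w: "w \<in> carrier G" "z \<otimes> k = w \<otimes> (k \<otimes> z)"
        using z k by (simp_all add: w_def m_assoc mult_inv_cancel)
      ultimately have "?N #> (z \<otimes> k) = (?N #> w) \<otimes>\<^bsub>G Mod ?N\<^esub> (?N #> (k \<otimes> z))"
        using z k by (metis h.hom_mult m_closed)
      also have "?N #> w = \<one>\<^bsub>G Mod ?N\<^esub>"
        using w \<open>w \<in> ?N\<close> N_one by simp
      finally show ?thesis
        using z k by (metis h.hom_mult m_closed h.hom_closed Q.l_one)
    qed
    \<comment> \<open>The cosets of \<open>x\<close> and \<open>y\<close> keep the coprime exponents
      \<open>m\<close> and \<open>n\<close>, so their central commutator vanishes in the
      quotient.\<close>
    have "?N #> z = \<one>\<^bsub>G Mod ?N\<^esub>"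
    proof (rule Q.central_commutator_trivial[of "?N #> x" "?N #> y" _ m n])
      show "(?N #> x) \<otimes>\<^bsub>G Mod ?N\<^esub> (?N #> y)
          = (?N #> z) \<otimes>\<^bsub>G Mod ?N\<^esub> ((?N #> y) \<otimes>\<^bsub>G Mod ?N\<^esub> (?N #> x))"
        using xy z zxy by (metis h.hom_mult m_closed)
      show "(?N #> x) [^]\<^bsub>G Mod ?N\<^esub> m = \<one>\<^bsub>G Mod ?N\<^esub>" "(?N #> y) [^]\<^bsub>G Mod ?N\<^esub> n = \<one>\<^bsub>G Mod ?N\<^esub>"
        using xy pow h.hom_one by (metis h.hom_nat_pow)+
    qed (use xy z central h.hom_closed \<open>coprime m n\<close> in auto)
    then show ?case
      using N_one z by blast
  qed (simp add: z)
  moreover obtain c where "lower_central G c = {\<one>}"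
    using assms(1) by (auto simp: nilpotent_group_def)
  ultimately have "z = \<one>"
    by blast
  then show ?thesis
    using zxy xy by simp
qed

lemma subgroup_pow_card:
  assumes "subgroup H G" "h \<in> H"
  shows "h [^] card H = \<one>"
  using group.pow_order_eq_1[OF subgroup_imp_group[OF assms(1)], of h] assms(2)
  by (simp add: order_def nat_pow_consistent[symmetric])

end

section \<open>Internal direct products of subgroups of coprime orders\<close>

context monoid
begin

text \<open>A list fixes the order of the factors, which need not commute. In
  \<open>add_monoid A\<close> this is \<open>brace_sum A (map a js)\<close>.\<close>

abbreviation ordered_prod :: "('i \<Rightarrow> 'a) \<Rightarrow> 'i list \<Rightarrow> 'a" where
  "ordered_prod a js \<equiv> foldr (\<otimes>) (map a js) \<one>"

lemma ordered_prod_closed: "a ` set js \<subseteq> carrier G \<Longrightarrow> ordered_prod a js \<in> carrier G"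
  by (induction js) auto

lemma ordered_prod_commute:
  assumes "c \<in> carrier G" "a ` set js \<subseteq> carrier G" "\<And>j. j \<in> set js \<Longrightarrow> c \<otimes> a j = a j \<otimes> c"
  shows "c \<otimes> ordered_prod a js = ordered_prod a js \<otimes> c"
  using assms
proof (induction js)
  case (Cons j js)
  let ?P = "ordered_prod a js"
  have P: "?P \<in> carrier G" "a j \<in> carrier G"
    using Cons.prems by (auto intro!: ordered_prod_closed)
  have "c \<otimes> (a j \<otimes> ?P) = a j \<otimes> (c \<otimes> ?P)"
    using P Cons.prems by (simp add: m_assoc[symmetric])
  also have "c \<otimes> ?P = ?P \<otimes> c"
    using Cons by simp
  finally show ?case
    using P Cons.prems by (simp add: m_assoc)
qed simp

text \<open>Splitting the product moves the head \<open>b j\<close> past every later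
  \<open>a i\<close>. Distinctness of the list gives \<open>i \<noteq> j\<close> there, so the two
  commute.\<close>

lemma ordered_prod_mult:
  assumes "distinct js" "a ` set js \<subseteq> carrier G" "b ` set js \<subseteq> carrier G"
    and "\<And>i j. i \<in> set js \<Longrightarrow> j \<in> set js \<Longrightarrow> i \<noteq> j \<Longrightarrow> a i \<otimes> b j = b j \<otimes> a i"
  shows "ordered_prod (\<lambda>j. a j \<otimes> b j) js = ordered_prod a js \<otimes> ordered_prod b js"
  using assms
proof (induction js)
  case (Cons j js)
  let ?A = "ordered_prod a js" and ?B = "ordered_prod b js"
  have c: "?A \<in> carrier G" "?B \<in> carrier G" "a j \<in> carrier G" "b j \<in> carrier G"
    using Cons.prems by (auto intro!: ordered_prod_closed)
  have "b j \<otimes> ?A = ?A \<otimes> b j"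
  proof (rule ordered_prod_commute)
    show "b j \<otimes> a i = a i \<otimes> b j" if "i \<in> set js" for i
      using Cons.prems(1) Cons.prems(4)[of i j] that by force
  qed (use Cons.prems in auto)
  then have "b j \<otimes> (?A \<otimes> ?B) = ?A \<otimes> (b j \<otimes> ?B)"
    using c by (simp add: m_assoc[symmetric])
  moreover have "ordered_prod (\<lambda>j. a j \<otimes> b j) js = ?A \<otimes> ?B"
    using Cons.prems by (intro Cons.IH) auto
  ultimately show ?case
    using c by (simp add: m_assoc)
qed simp

lemma ordered_prod_one: "(\<And>j. j \<in> set js \<Longrightarrow> a j = \<one>) \<Longrightarrow> ordered_prod a js = \<one>"
  by (induction js) auto

lemma ordered_prod_single:
  assumes "distinct js" "j \<in> set js" "a j \<in> carrier G" "\<And>i. i \<in> set js \<Longrightarrow> i \<noteq> j \<Longrightarrow> a i = \<one>"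
  shows "ordered_prod a js = a j"
  using assms
proof (induction js)
  case (Cons i js)
  show ?case
  proof (cases "i = j")
    case True
    have "ordered_prod a js = \<one>"
      using Cons.prems True by (intro ordered_prod_one) auto
    then show ?thesis
      using True Cons.prems by simp
  next
    case False
    then show ?thesis
      using Cons by auto
  qed
qed simp

end

text \<open>The order count \<open>card_prod\<close> stands in for generation: it makes the product
  map surjective once it is injective. The same subgroups are later used both in the additive and in
  the circle group.\<close>

locale coprime_subgroup_family = group G for G (structure) +
  fixes H :: "'i \<Rightarrow> 'a set" and js :: "'i list"
  assumes fin: "finite (carrier G)"
    and dist: "distinct js"
    and sub: "j \<in> set js \<Longrightarrow> subgroup (H j) G"
    and comm: "\<lbrakk>i \<in> set js; j \<in> set js; i \<noteq> j; x \<in> H i; y \<in> H j\<rbrakk> \<Longrightarrow> x \<otimes> y = y \<otimes> x"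
    and copr: "\<lbrakk>i \<in> set js; j \<in> set js; i \<noteq> j\<rbrakk> \<Longrightarrow> coprime (card (H i)) (card (H j))"
    and card_prod: "(\<Prod>j\<in>set js. card (H j)) = order G"
begin

section \<open>Componentwise calculation and the decomposition of the group\<close>

lemma family_closed: "a \<in> (\<Pi> j\<in>set js. H j) \<Longrightarrow> a ` set js \<subseteq> carrier G"
  using sub subgroup.subset by fastforce

lemma family_mult:
  assumes "a \<in> (\<Pi> j\<in>set js. H j)" "b \<in> (\<Pi> j\<in>set js. H j)"
  shows "ordered_prod (\<lambda>j. a j \<otimes> b j) js = ordered_prod a js \<otimes> ordered_prod b js"
  using assms comm by (intro ordered_prod_mult dist family_closed) blast+

lemma family_pow_mem:
  fixes k :: nat
  assumes "a \<in> (\<Pi> j\<in>set js. H j)"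
  shows "(\<lambda>j. a j [^] k) \<in> (\<Pi> j\<in>set js. H j)"
proof (induction k)
  case (Suc k)
  then show ?case
    using assms sub by (auto simp: Pi_iff subgroup.m_closed)
qed (use sub subgroup.one_closed in auto)

lemma family_pow:
  fixes k :: nat
  assumes "a \<in> (\<Pi> j\<in>set js. H j)"
  shows "ordered_prod (\<lambda>j. a j [^] k) js = ordered_prod a js [^] k"
proof (induction k)
  case (Suc k)
  then show ?case
    using family_mult[OF family_pow_mem[OF assms] assms, of k] by simp
qed (simp add: ordered_prod_one)

text \<open>The product \<open>e\<close> of the other orders annihilates all components except the
  one at \<open>j\<close>, so the \<open>e\<close>-th power of the trivial product is
  \<open>a j [^] e\<close>. As \<open>e\<close> is coprime to \<open>card (H j)\<close>, which also
  annihilates \<open>a j\<close>, this component is trivial.\<close>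

lemma family_trivial_kernel:
  assumes a: "a \<in> (\<Pi> j\<in>set js. H j)" and one: "ordered_prod a js = \<one>" and j: "j \<in> set js"
  shows "a j = \<one>"
proof -
  define e where "e = (\<Prod>i\<in>set js - {j}. card (H i))"
  have aj: "a j \<in> carrier G"
    using family_closed[OF a] j by blast
  have e1: "a i [^] e = \<one>" if i: "i \<in> set js" "i \<noteq> j" for i
  proof -
    have "card (H i) dvd e"
      unfolding e_def using i by (intro dvd_prodI) auto
    then obtain d where "e = card (H i) * d" ..
    moreover have "a i [^] card (H i) = \<one>" "a i \<in> carrier G"
      using a i sub subgroup_pow_card family_closed[OF a] by blast+
    ultimately show ?thesis
      by (metis nat_pow_pow nat_pow_one)
  qed
  have "a j [^] e = ordered_prod (\<lambda>j. a j [^] e) js"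
    using aj j e1 by (intro ordered_prod_single[symmetric] dist) auto
  then have "a j [^] e = \<one>"
    using family_pow[OF a, of e] one by simp
  moreover have "a j [^] card (H j) = \<one>"
    using a j sub subgroup_pow_card by blast
  moreover have "coprime e (card (H j))"
    unfolding e_def using copr j by (intro prod_coprime_left) auto
  ultimately show ?thesis
    using coprime_pow_trivial[OF aj] by blast
qed

text \<open>The componentwise quotient of \<open>a\<close> by \<open>b\<close> has trivial product
  by \<open>family_mult\<close>, which reduces the claim to the trivial kernel.\<close>

lemma family_inj:
  assumes a: "a \<in> (\<Pi> j\<in>set js. H j)" and b: "b \<in> (\<Pi> j\<in>set js. H j)"
    and eq: "ordered_prod a js = ordered_prod b js" and j: "j \<in> set js"
  shows "a j = b j"
proof -
  let ?c = "\<lambda>j. a j \<otimes> inv (b j)"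
  have ab: "a i \<in> carrier G" "b i \<in> carrier G" if "i \<in> set js" for i
    using that family_closed[OF a] family_closed[OF b] by auto
  have c: "?c \<in> (\<Pi> j\<in>set js. H j)"
    using a b sub by (auto simp: Pi_iff subgroup.m_closed subgroup.m_inv_closed)
  have "map (\<lambda>j. ?c j \<otimes> b j) js = map a js"
    using ab by (simp add: m_assoc)
  then have "ordered_prod (\<lambda>j. ?c j \<otimes> b j) js = ordered_prod a js"
    by (simp only:)
  then have "ordered_prod ?c js \<otimes> ordered_prod b js = ordered_prod a js"
    using family_mult[OF c b] by simp
  then have "ordered_prod ?c js = \<one>"
    using eq r_cancel_one[OF ordered_prod_closed[OF family_closed[OF b]]
        ordered_prod_closed[OF family_closed[OF c]]] by simp
  from family_trivial_kernel[OF c this j] show ?thesis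
    using ab[OF j] by (simp add: inv_solve_right')
qed

text \<open>Extensional families make a family equal to its values on \<open>js\<close>, so the
  domain is finite with \<open>order G\<close> elements and injectivity gives surjectivity.\<close>

lemma family_bij:
  "bij_betw (\<lambda>a. ordered_prod a js) (\<Pi>\<^sub>E j\<in>set js. H j) (carrier G)"
proof -
  let ?P = "\<Pi>\<^sub>E j\<in>set js. H j" and ?f = "\<lambda>a. ordered_prod a js"
  have inj: "inj_on ?f ?P"
  proof (rule inj_onI)
    fix a b assume *: "a \<in> ?P" "b \<in> ?P" "?f a = ?f b"
    have "a j = b j" if "j \<in> set js" for j
      by (rule family_inj[OF _ _ *(3) that]) (use * in \<open>auto simp: PiE_def\<close>)
    then show "a = b"
      by (rule PiE_ext[OF *(1,2)])
  qed
  have "?f ` ?P = carrier G"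
  proof (rule card_subset_eq[OF fin])
    show "?f ` ?P \<subseteq> carrier G"
      using ordered_prod_closed[OF family_closed] by (auto simp only: PiE_def)
    show "card (?f ` ?P) = card (carrier G)"
      using card_prod by (simp add: card_image[OF inj] card_PiE order_def)
  qed
  with inj show ?thesis
    by (simp add: bij_betw_def)
qed

text \<open>Powers are taken componentwise, so every component of \<open>x\<close> has exponent
  \<open>m\<close>. Coprimality removes those away from \<open>j\<close>, leaving
  \<open>x = a j\<close>.\<close>

lemma family_mem:
  fixes m :: nat
  assumes x: "x \<in> carrier G" "x [^] m = \<one>" and j: "j \<in> set js"
    and cop: "\<And>i. i \<in> set js \<Longrightarrow> i \<noteq> j \<Longrightarrow> coprime m (card (H i))"
  shows "x \<in> H j"
proof -
  obtain a where aE: "a \<in> (\<Pi>\<^sub>E j\<in>set js. H j)" and xa: "x = ordered_prod a js"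
    using x(1) bij_betw_imp_surj_on[OF family_bij] by blast
  from aE have a: "a \<in> (\<Pi> j\<in>set js. H j)"
    by (simp add: PiE_def)
  have ac: "a i \<in> carrier G" if "i \<in> set js" for i
    using that family_closed[OF a] by auto
  have "a i = \<one>" if i: "i \<in> set js" "i \<noteq> j" for i
  proof -
    have "a i [^] m = \<one>"
      using family_trivial_kernel[OF family_pow_mem[OF a] _ i(1)] family_pow[OF a, of m] x xa by simp
    moreover have "a i [^] card (H i) = \<one>"
      using a i sub subgroup_pow_card by blast
    ultimately show ?thesis
      using coprime_pow_trivial[OF ac[OF i(1)]] cop[OF i] by blast
  qed
  then have "x = a j"
    unfolding xa using j ac by (intro ordered_prod_single dist) auto
  then show ?thesis
    using a j by blast
qed

end

section \<open>Sylow subgroups of nilpotent groups\<close>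

context group
begin

lemma coprime_subgroups_commute:
  assumes "nilpotent_group G" "subgroup H G" "subgroup K G" "coprime (card H) (card K)"
    and "x \<in> H" "y \<in> K"
  shows "x \<otimes> y = y \<otimes> x"
proof (rule coprime_pow_commute)
  show "x [^] card H = \<one>" "y [^] card K = \<one>"
    using assms by (auto intro: subgroup_pow_card)
qed (use assms in \<open>auto intro: subgroup.mem_carrier\<close>)

text \<open>Coprimality kills the components of a \<open>p\<close>-element at the other primes, so
  one exponent condition cuts out \<open>P\<close>. Hence \<open>P\<close> is the only subgroup of
  its order, and every endomorphism maps it into itself.\<close>

lemma nilpotent_sylow_mem_iff:
  assumes "nilpotent_group G" and fin: "finite (carrier G)"
    and p: "Factorial_Ring.prime p" "p dvd order G"
    and P: "subgroup P G" "card P = p ^ multiplicity p (order G)"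
  shows "x \<in> P \<longleftrightarrow> x \<in> carrier G \<and> x [^] (p ^ multiplicity p (order G)) = \<one>"
proof -
  have pos: "order G > 0"
    using fin by (simp add: order_gt_0_iff_finite)
  have "\<exists>H. subgroup H G \<and> card H = q ^ multiplicity q (order G)" if "q \<in> prime_factors (order G)" for q
    using sylow_thm[of q G "multiplicity q (order G)" "order G div q ^ multiplicity q (order G)"]
      that fin is_group by (simp add: multiplicity_dvd in_prime_factors_imp_prime)
  then obtain S where S: "\<And>q. q \<in> prime_factors (order G) \<Longrightarrow>
      subgroup (S q) G \<and> card (S q) = q ^ multiplicity q (order G)"
    by metis
  have pin: "p \<in> prime_factors (order G)"
    using p pos by (simp add: in_prime_factors_iff)
  \<comment> \<open>Sylow subgroups chosen at the other primes complete the given \<open>P\<close>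
    to a coprime family whose orders multiply to \<open>order G\<close>.\<close>
  define H where "H = S(p := P)"
  have H: "subgroup (H q) G" "card (H q) = q ^ multiplicity q (order G)"
    if "q \<in> prime_factors (order G)" for q
    using S[OF that] P by (auto simp: H_def)
  have cop: "coprime (card (H q)) (card (H r))"
    if "q \<in> prime_factors (order G)" "r \<in> prime_factors (order G)" "q \<noteq> r" for q r
    using that H by (auto simp: primes_coprime in_prime_factors_iff)
  define js where "js = sorted_list_of_set (prime_factors (order G))"
  have js: "set js = prime_factors (order G)" "distinct js"
    by (simp_all add: js_def)
  interpret coprime_subgroup_family G H js
  proof (intro coprime_subgroup_family.intro coprime_subgroup_family_axioms.intro is_group)
    show "(\<Prod>j\<in>set js. card (H j)) = order G"
      using prime_factorization_nat[OF pos] H by (simp add: js)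
    fix i j x y
    assume ij: "i \<in> set js" "j \<in> set js" "i \<noteq> j" "x \<in> H i" "y \<in> H j"
    then show "x \<otimes> y = y \<otimes> x"
      using coprime_subgroups_commute[OF assms(1)] H cop js by metis
  qed (use js fin H cop in auto)
  show ?thesis
  proof
    assume "x \<in> P"
    then show "x \<in> carrier G \<and> x [^] (p ^ multiplicity p (order G)) = \<one>"
      using P subgroup_pow_card[OF P(1)] subgroup.mem_carrier[OF P(1)] by simp
  next
    assume x: "x \<in> carrier G \<and> x [^] (p ^ multiplicity p (order G)) = \<one>"
    then have "x \<in> H p"
      using H(2)[OF pin] cop[OF pin] js pin by (intro family_mem) auto
    then show "x \<in> P"
      by (simp add: H_def)
  qed
qed

text \<open>Powers of a conjugate are conjugates of powers, so conjugation respects the exponent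
  condition.\<close>

lemma nilpotent_sylow_normal:
  assumes "nilpotent_group G" "finite (carrier G)" "sylow_subgroup G P"
  shows "P \<lhd> G"
proof -
  obtain p where p: "Factorial_Ring.prime p" "p dvd order G"
    and P: "subgroup P G" "card P = p ^ multiplicity p (order G)"
    using assms(3) by (auto simp: sylow_subgroup_def)
  note mem = nilpotent_sylow_mem_iff[OF assms(1,2) p P]
  have conj: "(g \<otimes> x \<otimes> inv g) [^] k = g \<otimes> x [^] k \<otimes> inv g"
    if "g \<in> carrier G" "x \<in> carrier G" for g x and k :: nat
    using that by (induction k) (simp_all add: m_assoc mult_inv_cancel)
  show ?thesis
    by (rule normal_invI[OF P(1)]) (auto simp: mem conj)
qed

text \<open>Sending each index to the prime of its subgroup is a bijection onto the prime factors of
  \<open>order G\<close>, so the orders multiply to \<open>order G\<close> by prime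
  factorization.\<close>

lemma sylow_family:
  assumes "nilpotent_group G" and fin: "finite (carrier G)" and "distinct js"
    and bij: "bij_betw H (set js) {P. sylow_subgroup G P}"
  shows "coprime_subgroup_family G H js"
proof -
  have pos: "order G > 0"
    using fin by (simp add: order_gt_0_iff_finite)
  have "\<exists>p. Factorial_Ring.prime p \<and> p dvd order G \<and> card (H j) = p ^ multiplicity p (order G)"
    and sub: "subgroup (H j) G" if "j \<in> set js" for j
    using bij_betwE[OF bij] that by (auto simp: sylow_subgroup_def)
  then obtain p where p: "\<And>j. j \<in> set js \<Longrightarrow>
      Factorial_Ring.prime (p j) \<and> p j dvd order G \<and> card (H j) = p j ^ multiplicity (p j) (order G)"
    by metis
  have mem: "x \<in> H j \<longleftrightarrow> x \<in> carrier G \<and> x [^] (p j ^ multiplicity (p j) (order G)) = \<one>"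
    if "j \<in> set js" for x j
    using p[OF that] sub[OF that] nilpotent_sylow_mem_iff[OF assms(1) fin] by blast
  \<comment> \<open>Sylow subgroups for one prime satisfy the same exponent condition and therefore
    coincide.\<close>
  have "H i = H j" if "i \<in> set js" "j \<in> set js" "p i = p j" for i j
    using mem that by auto
  then have inj: "inj_on p (set js)"
    using inj_onD[OF bij_betw_imp_inj_on[OF bij]] by (intro inj_onI) blast
  have "p ` set js = prime_factors (order G)"
  proof (intro equalityI subsetI)
    fix q assume "q \<in> p ` set js"
    then show "q \<in> prime_factors (order G)"
      using p pos by (auto simp: in_prime_factors_iff)
  next
    fix q assume q: "q \<in> prime_factors (order G)"
    obtain P where P: "subgroup P G" "card P = q ^ multiplicity q (order G)"
      using sylow_thm[of q G "multiplicity q (order G)" "order G div q ^ multiplicity q (order G)"]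
        q fin is_group by (auto simp: multiplicity_dvd in_prime_factors_imp_prime)
    then have "sylow_subgroup G P"
      using q by (auto simp: sylow_subgroup_def in_prime_factors_iff)
    then obtain j where j: "j \<in> set js" "P = H j"
      using bij by (auto simp: bij_betw_def)
    \<comment> \<open>The order of \<open>P\<close> is a positive power of \<open>q\<close> and also
      a power of \<open>p j\<close>, which forces the two primes to agree.\<close>
    have "q dvd card P"
      using P(2) q pos by (auto simp: in_prime_factors_iff prime_multiplicity_gt_zero_iff)
    then have "q dvd p j"
      using p[OF j(1)] j(2) q by (auto simp: in_prime_factors_iff dest: prime_dvd_power)
    then have "q = p j"
      using p[OF j(1)] q by (simp add: primes_dvd_imp_eq in_prime_factors_iff)
    then show "q \<in> p ` set js"
      using j by blast
  qed
  then have "(\<Prod>j\<in>set js. p j ^ multiplicity (p j) (order G)) = order G"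
    using prime_factorization_nat[OF pos] prod.reindex[OF inj, of "\<lambda>q. q ^ multiplicity q (order G)"]
    by simp
  then have prod: "(\<Prod>j\<in>set js. card (H j)) = order G"
    using p by simp
  have cop: "coprime (card (H i)) (card (H j))"
    if "i \<in> set js" "j \<in> set js" "i \<noteq> j" for i j
    using that p[of i] p[of j] inj by (auto simp: primes_coprime inj_on_eq_iff)
  show ?thesis
  proof (intro coprime_subgroup_family.intro coprime_subgroup_family_axioms.intro is_group)
    fix i j x y assume "i \<in> set js" "j \<in> set js" "i \<noteq> j" "x \<in> H i" "y \<in> H j"
    then show "x \<otimes> y = y \<otimes> x"
      using coprime_subgroups_commute[OF assms(1)] sub cop by metis
  qed (use assms sub prod cop in auto)
qed

end

section \<open>Skew left braces\<close>

context skew_left_brace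
begin

text \<open>The rewrites state additive facts in the ring notation and over the carrier shared with
  the circle group.\<close>

sublocale add: group "add_monoid A"
  rewrites "carrier (add_monoid A) = carrier A"
    and "monoid.mult (add_monoid A) = (\<oplus>)"
    and "monoid.one (add_monoid A) = \<zero>"
    and "m_inv (add_monoid A) = a_inv A"
  by (rule add_group) (auto simp: a_inv_def fun_eq_iff)

sublocale mult: group A
  by (rule mult_group)

lemma lambda_closed: "a \<in> carrier A \<Longrightarrow> b \<in> carrier A \<Longrightarrow> brace_lambda A a b \<in> carrier A"
  by (simp add: brace_lambda_def)

lemma mult_eq_add_lambda:
  "a \<in> carrier A \<Longrightarrow> b \<in> carrier A \<Longrightarrow> a \<otimes> b = a \<oplus> brace_lambda A a b"
  by (simp add: brace_lambda_def add.m_assoc[symmetric])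

text \<open>Adding \<open>\<ominus> a\<close> on the left of the brace law leaves exactly the sum of
  the two lambda values.\<close>

lemma lambda_hom:
  assumes "a \<in> carrier A"
  shows "brace_lambda A a \<in> hom (add_monoid A) (add_monoid A)"
  using assms brace_compat
  by (auto simp: hom_def brace_lambda_def a_minus_def add.m_assoc)

lemma lambda_zero: "a \<in> carrier A \<Longrightarrow> brace_lambda A a \<zero> = \<zero>"
  using hom_one[OF lambda_hom add_group add_group] by simp

text \<open>Evaluate \<open>\<one> \<otimes> \<zero>\<close> twice: it is \<open>\<zero>\<close>,
  and also \<open>\<one> \<oplus> brace_lambda A \<one> \<zero> = \<one>\<close>.\<close>

lemma zero_eq_one: "\<zero> = \<one>"
  using lambda_zero[of \<one>] mult_eq_add_lambda[of \<one> \<zero>] by simp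

lemma mult_zero: "a \<in> carrier A \<Longrightarrow> a \<otimes> \<zero> = a"
  by (simp add: zero_eq_one)

section \<open>Additive Sylow subgroups as ideals\<close>

lemma sylow_lambda_closed:
  assumes fin: "finite (carrier A)" and nil: "nilpotent_group (add_monoid A)"
    and S: "sylow_subgroup (add_monoid A) P" and a: "a \<in> carrier A" and x: "x \<in> P"
  shows "brace_lambda A a x \<in> P"
proof -
  let ?M = "add_monoid A"
  obtain p where p: "Factorial_Ring.prime p" "p dvd order ?M"
    and P: "subgroup P ?M" "card P = p ^ multiplicity p (order ?M)"
    using S by (auto simp: sylow_subgroup_def)
  define q where "q = p ^ multiplicity p (order ?M)"
  have mem: "y \<in> P \<longleftrightarrow> y \<in> carrier A \<and> y [^]\<^bsub>?M\<^esub> q = \<zero>" for y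
    using group.nilpotent_sylow_mem_iff[OF add_group nil _ p P, of y] fin by (simp add: q_def)
  \<comment> \<open>An additive map commutes with \<open>q\<close>-fold multiples, so it preserves
    the exponent condition defining \<open>P\<close>.\<close>
  have "brace_lambda A a x [^]\<^bsub>?M\<^esub> q = \<zero>"
    using hom_nat_pow[OF lambda_hom[OF a], of x q] x mem add_group a by (simp add: lambda_zero)
  then show ?thesis
    using mem x lambda_closed[OF a] by blast
qed

lemma left_ideal_subgroup_mult:
  assumes "brace_left_ideal P A"
  shows "subgroup P A"
proof -
  have S: "subgroup P (add_monoid A)"
    and L: "\<And>a x. a \<in> carrier A \<Longrightarrow> x \<in> P \<Longrightarrow> brace_lambda A a x \<in> P"
    using assms by (auto simp: brace_left_ideal_def)
  have sub: "x \<in> carrier A" if "x \<in> P" for x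
    using subgroup.subset[OF S] that by auto
  show ?thesis
  proof (rule mult.subgroupI)
    show "P \<subseteq> carrier A" "P \<noteq> {}"
      using sub subgroup.one_closed[OF S] by auto
    show "x \<otimes> y \<in> P" if "x \<in> P" "y \<in> P" for x y
      using subgroup.m_closed[OF S] L sub that by (simp add: mult_eq_add_lambda)
    fix x assume x: "x \<in> P"
    let ?y = "inv x"
    \<comment> \<open>This is \<open>inv x \<otimes> x = \<one>\<close> rewritten additively; it
      exhibits the circle inverse as the negative of an element of \<open>P\<close>.\<close>
    have "?y \<oplus> brace_lambda A ?y x = \<zero>"
      using x sub by (simp add: mult_eq_add_lambda[symmetric] zero_eq_one)
    then have "?y = \<ominus> brace_lambda A ?y x"
      using x sub lambda_closed by (metis add.inv_equality mult.inv_closed)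
    then show "?y \<in> P"
      using subgroup.m_inv_closed[OF S L[of ?y x]] x sub by (simp add: a_inv_def)
  qed
qed

lemma sylow_left_ideal:
  assumes "finite (carrier A)" "nilpotent_group (add_monoid A)"
    and "sylow_subgroup (add_monoid A) P"
  shows "brace_left_ideal P A"
  using assms sylow_lambda_closed by (auto simp: brace_left_ideal_def sylow_subgroup_def)

text \<open>Both groups have the same carrier, hence the same order, so the cardinality condition
  transfers unchanged.\<close>

lemma sylow_subgroup_mult:
  assumes "finite (carrier A)" "nilpotent_group (add_monoid A)"
    and "sylow_subgroup (add_monoid A) P"
  shows "sylow_subgroup A P"
  using left_ideal_subgroup_mult[OF sylow_left_ideal[OF assms]] assms(3)
  by (auto simp: sylow_subgroup_def order_def)

lemma sylow_ideal:
  assumes "finite (carrier A)" "nilpotent_group (add_monoid A)" "nilpotent_group A"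
    and "sylow_subgroup (add_monoid A) P"
  shows "brace_ideal P A"
proof -
  have "P \<lhd> A"
    using mult.nilpotent_sylow_normal sylow_subgroup_mult assms by blast
  moreover have "P \<lhd> add_monoid A"
    using group.nilpotent_sylow_normal[OF add_group] assms by simp
  ultimately show ?thesis
    using sylow_left_ideal[OF assms(1,2,4)] normal.coset_eq[of P A]
      normal.coset_eq[of P "add_monoid A"]
    by (simp add: brace_ideal_def a_l_coset_def a_r_coset_def)
qed

text \<open>Comparing \<open>x + \<lambda>\<^sub>x(y) = x \<circ> y = y \<circ> x = y + \<lambda>\<^sub>y(x)\<close> puts \<open>x - \<lambda>\<^sub>y(x) = y - \<lambda>\<^sub>x(y)\<close>
  into \<open>P \<inter> Q = 0\<close>.\<close>

lemma mult_eq_add_of_commuting_left_ideals: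
  assumes P: "brace_left_ideal P A" and Q: "brace_left_ideal Q A" and PQ: "P \<inter> Q = {\<zero>}"
    and add_comm: "\<And>x y. x \<in> P \<Longrightarrow> y \<in> Q \<Longrightarrow> x \<oplus> y = y \<oplus> x"
    and mult_comm: "\<And>x y. x \<in> P \<Longrightarrow> y \<in> Q \<Longrightarrow> x \<otimes> y = y \<otimes> x"
    and x: "x \<in> P" and y: "y \<in> Q"
  shows "x \<otimes> y = x \<oplus> y"
proof -
  have S: "subgroup P (add_monoid A)" "subgroup Q (add_monoid A)"
    using P Q by (auto simp: brace_left_ideal_def)
  have c: "x \<in> carrier A" "y \<in> carrier A"
    using x y subgroup.mem_carrier[OF S(1)] subgroup.mem_carrier[OF S(2)] by auto
  define u v where "u = brace_lambda A y x" and "v = brace_lambda A x y"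
  have uv: "u \<in> P" "v \<in> Q" "u \<in> carrier A" "v \<in> carrier A"
    using P Q x y c lambda_closed unfolding u_def v_def brace_left_ideal_def by blast+
  have "x \<oplus> v = y \<oplus> u"
    using mult_comm[OF x y] c by (simp add: u_def v_def mult_eq_add_lambda)
  also have "\<dots> = u \<oplus> y"
    using add_comm[OF uv(1) y] by simp
  finally have "(\<ominus> u) \<oplus> (x \<oplus> v) = y"
    using uv c by (simp add: add.m_assoc[symmetric])
  then have "(\<ominus> u) \<oplus> x = y \<oplus> (\<ominus> v)"
    using uv c by (simp add: add.inv_solve_right add.m_assoc)
  moreover have "(\<ominus> u) \<oplus> x \<in> P" "y \<oplus> (\<ominus> v) \<in> Q"
    using S uv x y subgroup.m_closed[OF S(1)] subgroup.m_closed[OF S(2)]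
      subgroup.m_inv_closed[OF S(1)] subgroup.m_inv_closed[OF S(2)]
    by (auto simp: a_inv_def)
  ultimately have "y \<oplus> (\<ominus> v) = \<zero>"
    using PQ by auto
  \<comment> \<open>Thus \<open>brace_lambda A x\<close> fixes \<open>y\<close>, and
    \<open>x \<otimes> y = x \<oplus> v\<close> becomes the claim.\<close>
  then have "y = v"
    using uv c by (simp add: add.inv_solve_right')
  then show ?thesis
    using c by (simp add: mult_eq_add_lambda v_def)
qed

text \<open>The hypothesis says that \<open>brace_lambda A x\<close> fixes every \<open>a j\<close>;
  by additivity it fixes their sum. In the induction, the inner \<open>\<ominus> x\<close> from the
  brace law cancels the \<open>x\<close> supplied by the tail.\<close>

lemma mult_eq_add_foldr:
  assumes "x \<in> carrier A" "a ` set js \<subseteq> carrier A" "\<And>j. j \<in> set js \<Longrightarrow> x \<otimes> a j = x \<oplus> a j"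
  shows "x \<otimes> foldr (\<oplus>) (map a js) \<zero> = x \<oplus> foldr (\<oplus>) (map a js) \<zero>"
  using assms
proof (induction js)
  case (Cons j js)
  let ?S = "foldr (\<oplus>) (map a js) \<zero>"
  have c: "?S \<in> carrier A" "a j \<in> carrier A"
    using Cons.prems add.ordered_prod_closed[of a js] by auto
  have "x \<otimes> (a j \<oplus> ?S) = (x \<otimes> a j \<ominus> x) \<oplus> (x \<otimes> ?S)"
    using c Cons.prems by (intro brace_compat)
  also have "\<dots> = (x \<oplus> a j \<ominus> x) \<oplus> (x \<oplus> ?S)"
    using Cons by simp
  also have "\<dots> = x \<oplus> (a j \<oplus> ?S)"
    using c Cons.prems(1) by (simp add: a_minus_def add.m_assoc) (simp add: add.m_assoc[symmetric])
  finally show ?case by simp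
qed (simp add: mult_zero)

text \<open>The head index differs from all later ones, so its sum with the tail may be replaced by
  the circle product. This makes the additive and the circle decomposition one map.\<close>

lemma brace_sum_eq_mult:
  assumes "distinct js" "a ` set js \<subseteq> carrier A"
    and "\<And>i j. i \<in> set js \<Longrightarrow> j \<in> set js \<Longrightarrow> i \<noteq> j \<Longrightarrow> a i \<otimes> a j = a i \<oplus> a j"
  shows "foldr (\<oplus>) (map a js) \<zero> = foldr (\<otimes>) (map a js) \<one>"
  using assms
proof (induction js)
  case (Cons j js)
  have "a j \<otimes> foldr (\<oplus>) (map a js) \<zero> = a j \<oplus> foldr (\<oplus>) (map a js) \<zero>"
    using Cons.prems(1,2) by (intro mult_eq_add_foldr Cons.prems(3)) auto
  moreover have "foldr (\<oplus>) (map a js) \<zero> = foldr (\<otimes>) (map a js) \<one>"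
    using Cons.prems by (intro Cons.IH) auto
  ultimately show ?case by simp
qed (simp add: zero_eq_one)

end

text \<open>HOL functions are total, so uniqueness of \<open>f\<close> is stated among functions
  extensional on the carrier; the isomorphism claim depends only on the values there.\<close>

theorem corollary4p3:
  fixes A :: "('a, 'm) ring_scheme" and I :: "nat \<Rightarrow> 'a set" and n :: nat
  assumes "skew_left_brace A"
    and "finite (carrier A)"
    and "nilpotent_group (add_monoid A)"
    and "nilpotent_group A"
    and "bij_betw I {1..n} {P. sylow_subgroup (add_monoid A) P}"
  shows "(\<forall>j\<in>{1..n}. brace_ideal (I j) A) \<and>
    (\<exists>!f. f \<in> extensional (carrier A) \<and>
       (\<forall>a\<in>(\<Pi>\<^sub>E j\<in>{1..n}. I j). f (brace_sum A (map a [1..<Suc n])) = a)) \<and>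
    (\<forall>f. (\<forall>a\<in>(\<Pi>\<^sub>E j\<in>{1..n}. I j). f (brace_sum A (map a [1..<Suc n])) = a) \<longrightarrow>
       f \<in> brace_iso A (brace_product {1..n} (\<lambda>j. A\<lparr>carrier := I j\<rparr>)))"
proof -
  interpret skew_left_brace A by fact
  define js where "js = [1..<Suc n]"
  have js: "set js = {1..n}" "distinct js"
    by (auto simp: js_def)
  interpret S: coprime_subgroup_family "add_monoid A" I js
    using assms js by (intro group.sylow_family add_group) auto
  have syl: "sylow_subgroup (add_monoid A) (I j)" if "j \<in> set js" for j
    using bij_betwE[OF assms(5)] that js by auto
  have left: "brace_left_ideal (I j) A" if "j \<in> set js" for j
    using sylow_left_ideal syl that assms by blast
  have subm: "subgroup (I j) A" if "j \<in> set js" for j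
    using left_ideal_subgroup_mult left that by blast
  \<comment> \<open>Orders and coprimality carry over from the additive group; commutation comes
    from nilpotency of the circle group.\<close>
  interpret C: coprime_subgroup_family A I js
  proof (intro coprime_subgroup_family.intro coprime_subgroup_family_axioms.intro mult_group)
    show "(\<Prod>j\<in>set js. card (I j)) = order A"
      using S.card_prod by (simp add: order_def)
    show "x \<otimes>\<^bsub>A\<^esub> y = y \<otimes>\<^bsub>A\<^esub> x"
      if "i \<in> set js" "j \<in> set js" "i \<noteq> j" "x \<in> I i" "y \<in> I j" for i j x y
      using mult.coprime_subgroups_commute[OF assms(4) subm subm S.copr] that by blast
  qed (rule assms(2) js(2) subm S.copr; assumption)+
  have mult_add: "x \<otimes>\<^bsub>A\<^esub> y = x \<oplus>\<^bsub>A\<^esub> y"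
    if ij: "i \<in> set js" "j \<in> set js" "i \<noteq> j" and xy: "x \<in> I i" "y \<in> I j" for i j x y
  proof (rule mult_eq_add_of_commuting_left_ideals[OF left[OF ij(1)] left[OF ij(2)] _ _ _ xy])
    \<comment> \<open>An element of both subgroups has two coprime exponents, so they meet only in
      the neutral element.\<close>
    have "z = \<one>\<^bsub>A\<^esub>" if z: "z \<in> I i" "z \<in> I j" for z
    proof -
      have "z [^]\<^bsub>A\<^esub> card (I i) = \<one>\<^bsub>A\<^esub>" "z [^]\<^bsub>A\<^esub> card (I j) = \<one>\<^bsub>A\<^esub>" and zc: "z \<in> carrier A"
        using mult.subgroup_pow_card[OF subm[OF ij(1)] z(1)]
          mult.subgroup_pow_card[OF subm[OF ij(2)] z(2)] subgroup.mem_carrier[OF subm[OF ij(1)] z(1)]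
        by this
      then show ?thesis
        by (intro mult.coprime_pow_trivial[OF zc _ _ S.copr[OF ij]])
    qed
    then show "I i \<inter> I j = {\<zero>\<^bsub>A\<^esub>}"
      using subgroup.one_closed[OF subm[OF ij(1)]] subgroup.one_closed[OF subm[OF ij(2)]]
      unfolding zero_eq_one by blast
    show "x \<oplus>\<^bsub>A\<^esub> y = y \<oplus>\<^bsub>A\<^esub> x" if "x \<in> I i" "y \<in> I j" for x y
      using S.comm[OF ij that] by simp
    show "x \<otimes>\<^bsub>A\<^esub> y = y \<otimes>\<^bsub>A\<^esub> x" if "x \<in> I i" "y \<in> I j" for x y
      using C.comm[OF ij that] .
  qed
  let ?P = "\<Pi>\<^sub>E j\<in>{1..n}. I j" and ?s = "\<lambda>a. brace_sum A (map a js)"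
  let ?B = "brace_product {1..n} (\<lambda>j. A\<lparr>carrier := I j\<rparr>)"
  have sum_mult: "?s a = foldr (\<otimes>\<^bsub>A\<^esub>) (map a js) \<one>\<^bsub>A\<^esub>" if "a \<in> ?P" for a
    unfolding brace_sum_def
    using that js C.family_closed[of a] mult_add
    by (intro brace_sum_eq_mult) (auto simp: PiE_def Pi_iff)
  have bij: "bij_betw ?s ?P (carrier A)"
    using S.family_bij js by (simp add: brace_sum_def)
  have carrB: "carrier ?B = ?P"
    by (simp add: brace_product_def)
  \<comment> \<open>The operations of the product restrict their results to the index set;
    \<open>js\<close> lists only indices inside it.\<close>
  have map_restrict: "map (restrict a {1..n}) js = map a js" for a
    using js by auto
  have s_add: "a \<oplus>\<^bsub>?B\<^esub> b \<in> ?P" "?s (a \<oplus>\<^bsub>?B\<^esub> b) = ?s a \<oplus>\<^bsub>A\<^esub> ?s b"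
    and s_mult: "a \<otimes>\<^bsub>?B\<^esub> b \<in> ?P" "?s (a \<otimes>\<^bsub>?B\<^esub> b) = ?s a \<otimes>\<^bsub>A\<^esub> ?s b"
    if ab: "a \<in> ?P" "b \<in> ?P" for a b
  proof -
    have ab': "a \<in> (\<Pi> j\<in>set js. I j)" "b \<in> (\<Pi> j\<in>set js. I j)"
      using ab js by (auto simp: PiE_def)
    have eq: "a \<oplus>\<^bsub>?B\<^esub> b = restrict (\<lambda>j. a j \<oplus>\<^bsub>A\<^esub> b j) {1..n}"
      "a \<otimes>\<^bsub>?B\<^esub> b = restrict (\<lambda>j. a j \<otimes>\<^bsub>A\<^esub> b j) {1..n}"
      by (simp_all add: brace_product_def)
    have "a j \<oplus>\<^bsub>A\<^esub> b j \<in> I j" "a j \<otimes>\<^bsub>A\<^esub> b j \<in> I j" if "j \<in> {1..n}" for j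
      using that PiE_mem[OF ab(1) that] PiE_mem[OF ab(2) that] js(1)
        subgroup.m_closed[OF S.sub, of j "a j" "b j"] subgroup.m_closed[OF subm, of j "a j" "b j"]
      by simp_all
    then show P: "a \<oplus>\<^bsub>?B\<^esub> b \<in> ?P" "a \<otimes>\<^bsub>?B\<^esub> b \<in> ?P"
      by (simp_all only: eq restrict_PiE_iff) auto
    show "?s (a \<oplus>\<^bsub>?B\<^esub> b) = ?s a \<oplus>\<^bsub>A\<^esub> ?s b"
      using S.family_mult[OF ab'] by (simp only: eq map_restrict) (simp add: brace_sum_def)
    have "foldr (\<otimes>\<^bsub>A\<^esub>) (map (a \<otimes>\<^bsub>?B\<^esub> b) js) \<one>\<^bsub>A\<^esub>
        = foldr (\<otimes>\<^bsub>A\<^esub>) (map (\<lambda>j. a j \<otimes>\<^bsub>A\<^esub> b j) js) \<one>\<^bsub>A\<^esub>"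
      by (simp only: eq map_restrict)
    then show "?s (a \<otimes>\<^bsub>?B\<^esub> b) = ?s a \<otimes>\<^bsub>A\<^esub> ?s b"
      using C.family_mult[OF ab'] ab P by (simp add: sum_mult)
  qed
  have iso: "f \<in> brace_iso A ?B" if f: "\<forall>a\<in>?P. f (?s a) = a" for f
  proof -
    \<comment> \<open>Every element is the sum of a family, so the equation for \<open>f\<close>
      determines it on the carrier as the inverse of \<open>?s\<close>; it then inherits both
      homomorphism laws from \<open>?s\<close>.\<close>
    have fx: "\<exists>a\<in>?P. x = ?s a \<and> f x = a" if x: "x \<in> carrier A" for x
    proof -
      from x have "x \<in> ?s ` ?P"
        by (simp only: bij_betw_imp_surj_on[OF bij])
      then obtain a where a: "x = ?s a" "a \<in> ?P" ..
      moreover from a have "f x = a"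
        using bspec[OF f a(2)] by (simp only:)
      ultimately show ?thesis by (intro bexI conjI)
    qed
    have bf: "bij_betw f (carrier A) ?P"
    proof (rule bij_betw_byWitness[of _ ?s])
      show "\<forall>x\<in>carrier A. ?s (f x) = x" "f ` carrier A \<subseteq> ?P"
        using fx by fastforce+
      show "?s ` ?P \<subseteq> carrier A"
        by (simp only: bij_betw_imp_surj_on[OF bij] order_refl)
    qed (rule f)
    have "f (x \<oplus>\<^bsub>A\<^esub> y) = f x \<oplus>\<^bsub>?B\<^esub> f y" "f (x \<otimes>\<^bsub>A\<^esub> y) = f x \<otimes>\<^bsub>?B\<^esub> f y"
      if "x \<in> carrier A" "y \<in> carrier A" for x y
      using fx[OF that(1)] fx[OF that(2)] s_add s_mult f by metis+
    then show ?thesis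
      using bf bij_betwE[OF bf] by (simp add: brace_iso_def iso_def hom_def carrB Pi_iff del: One_nat_def)
  qed
  have inv_sum: "restrict (inv_into ?P ?s) (carrier A) (?s a) = a" if "a \<in> ?P" for a
    using inv_into_f_f[OF bij_betw_imp_inj_on[OF bij] that] bij_betw_apply[OF bij that]
    by (simp only: restrict_apply if_True)
  have "\<exists>!f. f \<in> extensional (carrier A) \<and> (\<forall>a\<in>?P. f (?s a) = a)"
  \<comment> \<open>The witness is the inverse of the bijective sum map, restricted to become
    extensional.\<close>
  proof (rule ex1I[of _ "restrict (inv_into ?P ?s) (carrier A)"])
    show "restrict (inv_into ?P ?s) (carrier A) \<in> extensional (carrier A) \<and>
        (\<forall>a\<in>?P. restrict (inv_into ?P ?s) (carrier A) (?s a) = a)"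
      using inv_sum by blast
    fix f assume f: "f \<in> extensional (carrier A) \<and> (\<forall>a\<in>?P. f (?s a) = a)"
    show "f = restrict (inv_into ?P ?s) (carrier A)"
    proof (rule extensionalityI[of _ "carrier A"])
      fix x assume x: "x \<in> carrier A"
      then have "x \<in> ?s ` ?P"
        by (simp only: bij_betw_imp_surj_on[OF bij])
      then obtain a where a: "x = ?s a" "a \<in> ?P" ..
      show "f x = restrict (inv_into ?P ?s) (carrier A) x"
        unfolding a(1) inv_sum[OF a(2)] using f a(2) by blast
    qed (use f in auto)
  qed
  with iso show ?thesis
    using sylow_ideal[OF assms(2-4)] syl js(1) by (auto simp: js_def simp del: upt_Suc)
qed

end
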